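(* Let $x$ be a complex number and $n$ a nonnegative integer such that all quantities below are defined (no zero denominators). Then \[ \sum_{k=0}^n(-1)^k\binom{n}{k}\frac{\binom{2x+n+k}{k}}{\binom{x+k}{k}}H_{k} =\begin{cases} H_m(x)+2H_{2m}-H_m, & n=2m;\\[1mm] H_m-2H_{2m+1}-H_m(x), & n=2m+1. \end{cases} \]
   Context: For a complex $y$ and an integer $k\ge 0$, $\binom{y}{k}=\frac{y(y-1)\cdots(y-k+1)}{k!}$. For a complex number $x$ and integer $n\ge0$, the generalized harmonic numbers are $H_0(x)=0$ and $H_n(x)=\sum_{k=1}^n\frac{1}{x+k}$; the classical harmonic numbers are $H_n=H_n(0)=\sum_{k=1}^n\frac1k$. *)

theory Defs
  imports "HOL-Analysis.Harmonic_Numbers"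
begin

definition gen_harm :: "nat \<Rightarrow> complex \<Rightarrow> complex" where
  "gen_harm n x = (\<Sum>k=1..n. 1 / (x + of_nat k))"

lemma gen_harm_0_left: "gen_harm 0 x = 0"
  by (simp add: gen_harm_def)

lemma gen_harm_0_right: "gen_harm n 0 = harm n"
  by (simp add: gen_harm_def harm_def inverse_eq_divide)

end

theory Submission imports Defs begin

text \<open>
  After rewriting the binomial quotient as
  \<open>(2x + n + 1)\<^sub>k / (x + 1)\<^sub>k\<close>, the terms without the harmonic factor sum to
  \<open>(-1)\<^sup>n\<close>, so adding the terms for \<open>n\<close> and \<open>n + 1\<close> gives a sequence that telescopes in \<open>k\<close>.
  Summation by parts against \<open>H\<^sub>k\<close> therefore turns the sum of two consecutive instances of the
  left-hand side into a plain hypergeometric sum with a factor \<open>1 / (k + 1)\<close>, which the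
  Chu-Vandermonde identity evaluates; the parity of \<open>n\<close> enters through the sign in that evaluation.
\<close>

section \<open>Rising factorials and the Chu-Vandermonde sum\<close>

text \<open>The terminating Gauss sum multiplied through by \<open>pochhammer c n\<close>, which
  leaves \<open>c\<close> unrestricted; it is applied with \<open>c = x\<close>, and
  \<open>x\<close> may be 0. Reflecting the second rising factorial reduces it to the binomial
  theorem for \<open>pochhammer\<close>.\<close>

lemma Chu_Vandermonde_pochhammer:
  fixes a c :: "'a :: field_char_0"
  shows "(\<Sum>j\<le>n. (- 1) ^ j * of_nat (n choose j) * pochhammer a j * pochhammer (c + of_nat j) (n - j))
       = pochhammer (c - a) n"
proof -
  have refl: "pochhammer (c + of_nat j) (n - j)
      = (- 1) ^ (n - j) * pochhammer (1 - c - of_nat n) (n - j)" if "j \<le> n" for j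
    using pochhammer_minus[of "c + of_nat n - 1" "n - j"] that
    by (simp add: of_nat_diff algebra_simps flip: power_add power_mult_distrib)
  have "(\<Sum>j\<le>n. (- 1) ^ j * of_nat (n choose j) * pochhammer a j * pochhammer (c + of_nat j) (n - j))
      = (\<Sum>j\<le>n. (- 1) ^ n * (of_nat (n choose j) * pochhammer a j * pochhammer (1 - c - of_nat n) (n - j)))"
  proof (rule sum.cong)
    fix j assume "j \<in> {..n}"
    then have "j \<le> n" by simp
    then have "(- 1 :: 'a) ^ n = (- 1) ^ j * (- 1) ^ (n - j)"
      by (simp flip: power_add)
    then show "(- 1) ^ j * of_nat (n choose j) * pochhammer a j * pochhammer (c + of_nat j) (n - j)
      = (- 1) ^ n * (of_nat (n choose j) * pochhammer a j * pochhammer (1 - c - of_nat n) (n - j))"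
      using refl[OF \<open>j \<le> n\<close>] by (simp add: mult_ac)
  qed simp
  also have "\<dots> = (- 1) ^ n * pochhammer (a + (1 - c - of_nat n)) n"
    by (simp add: pochhammer_binomial_sum sum_distrib_left)
  also have "\<dots> = pochhammer (c - a) n"
    using pochhammer_minus[of "a - c" n] by (simp add: algebra_simps)
  finally show ?thesis .
qed

lemma pochhammer_nonzero_iff_shift:
  fixes x :: "'a :: field_char_0"
  shows "pochhammer (x + 1) n \<noteq> 0 \<longleftrightarrow> (\<forall>j\<in>{1..n}. x + of_nat j \<noteq> 0)"
proof -
  have "pochhammer (x + 1) n = (\<Prod>j=1..n. x + of_nat j)"
    by (simp add: pochhammer_prod prod.atLeast1_atMost_eq lessThan_atLeast0 add_ac)
  then show ?thesis
    by simp
qed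

section \<open>Evaluation of the sum left over by summation by parts\<close>

text \<open>This is (n + 1) times 3F2(-n, 2x + n + 2, 1; x + 1, 2; 1): the factor 1/(k + 1) is
  absorbed into the binomial coefficient.\<close>

definition jacobi_sum :: "complex \<Rightarrow> nat \<Rightarrow> complex" where
  "jacobi_sum x n = (\<Sum>k\<le>n. (- 1) ^ k * of_nat (Suc n choose Suc k)
     * (pochhammer (2 * x + of_nat n + 2) k / pochhammer (x + 1) k))"

text \<open>The factor 2x + n + 1 extends the upper rising factorial downwards, so with j = k + 1
  the sum becomes, up to sign, a Chu-Vandermonde sum of order n + 1 with \<open>c = x\<close> that
  lacks its j = 0 term.\<close>

lemma jacobi_sum_times:
  assumes nz: "pochhammer (x + 1) n \<noteq> 0"
  shows "(2 * x + of_nat n + 1) * jacobi_sum x n = x + (- 1) ^ n * (x + of_nat n + 1)"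
proof -
  let ?a = "2 * x + of_nat n + 1"
  let ?q = "pochhammer (x + 1) n"
  have split: "?q = pochhammer (x + 1) k * pochhammer (x + 1 + of_nat k) (n - k)" if "k \<le> n" for k
    using pochhammer_product[OF that, of "x + 1"] .
  have "pochhammer (x - ?a) (Suc n)
      = (\<Sum>j\<le>Suc n. (- 1) ^ j * of_nat (Suc n choose j) * pochhammer ?a j
           * pochhammer (x + of_nat j) (Suc n - j))"
    by (rule Chu_Vandermonde_pochhammer[symmetric])
  also have "\<dots> = pochhammer x (Suc n) + (\<Sum>k\<le>n. (- 1) ^ Suc k * of_nat (Suc n choose Suc k)
       * pochhammer ?a (Suc k) * pochhammer (x + of_nat (Suc k)) (n - k))"
    by (subst sum.atMost_Suc_shift) simp
  also have "(\<Sum>k\<le>n. (- 1) ^ Suc k * of_nat (Suc n choose Suc k)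
       * pochhammer ?a (Suc k) * pochhammer (x + of_nat (Suc k)) (n - k))
     = - (?a * jacobi_sum x n * ?q)"
    unfolding jacobi_sum_def sum_distrib_left sum_distrib_right sum_negf[symmetric]
  proof (rule sum.cong)
    fix k assume "k \<in> {..n}"
    then have k: "k \<le> n" by simp
    then have "pochhammer (x + 1) k \<noteq> 0" using split[OF k] nz by auto
    moreover have "pochhammer ?a (Suc k) = ?a * pochhammer (2 * x + of_nat n + 2) k"
      by (simp add: pochhammer_rec add_ac)
    moreover have "x + of_nat (Suc k) = x + 1 + of_nat k"
      by simp
    ultimately show "(- 1) ^ Suc k * of_nat (Suc n choose Suc k)
       * pochhammer ?a (Suc k) * pochhammer (x + of_nat (Suc k)) (n - k)
      = - (?a * ((- 1) ^ k * of_nat (Suc n choose Suc k)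
         * (pochhammer (2 * x + of_nat n + 2) k / pochhammer (x + 1) k)) * ?q)"
      by (simp only: split[OF k]) (simp add: field_simps del: binomial_Suc_Suc)
  qed simp
  also have "pochhammer x (Suc n) = x * ?q"
    by (rule pochhammer_rec)
  \<comment> \<open>Since \<open>x - ?a\<close> is -(x + n + 1), reflection produces the sign that
    separates the parities.\<close>
  also have "pochhammer (x - ?a) (Suc n) = (- 1) ^ Suc n * ((x + of_nat n + 1) * ?q)"
    using pochhammer_minus[of "x + of_nat n + 1" "Suc n"] pochhammer_rec'[of "x + 1" n]
    by (simp add: algebra_simps)
  finally have "?a * jacobi_sum x n * ?q = (x + (- 1) ^ n * (x + of_nat n + 1)) * ?q"
    by (simp add: algebra_simps)
  then show ?thesis
    using nz by simp
qed

lemma pochhammer_nonzero_mono: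
  fixes x :: "'a :: field_char_0"
  assumes "pochhammer x n \<noteq> 0" "k \<le> n"
  shows "pochhammer x k \<noteq> 0"
  using assms pochhammer_product[of k n x] by auto

text \<open>For even \<open>n\<close> the right-hand side of \<open>jacobi_sum_times\<close> is 2x +
  n + 1 itself. Its zero -(n + 1)/2 is a half-integer, hence not excluded by
  \<open>nz\<close>.\<close>

lemma jacobi_sum_even:
  assumes nz: "pochhammer (x + 1) n \<noteq> 0" and "even n"
  shows "jacobi_sum x n = 1"
proof -
  have generic: "jacobi_sum y n = 1"
    if "pochhammer (y + 1) n \<noteq> 0" "2 * y + of_nat n + 1 \<noteq> 0" for y
  proof -
    have "(2 * y + of_nat n + 1) * jacobi_sum y n = (2 * y + of_nat n + 1) * 1"
      using jacobi_sum_times[OF that(1)] \<open>even n\<close> by (simp add: algebra_simps)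
    with that(2) show ?thesis
      by (subst (asm) mult_cancel_left) blast
  qed
  \<comment> \<open>If \<open>2x + n + 1 = 0\<close> that factor cannot be cancelled; pass to the limit instead.\<close>
  have poch_cont: "isCont (\<lambda>y. pochhammer (c * y + d) k) x" for c d :: complex and k
    unfolding pochhammer_prod by (intro continuous_intros)
  have "isCont (\<lambda>y. jacobi_sum y n) x"
    unfolding jacobi_sum_def
    using poch_cont[of 2 "of_nat n + 2"] poch_cont[of 1 1] pochhammer_nonzero_mono[OF nz]
    by (intro continuous_intros) (simp_all add: add.assoc)
  then have lim: "((\<lambda>y. jacobi_sum y n) \<longlongrightarrow> jacobi_sum x n) (at x)"
    by (simp add: isCont_def)
  have "((\<lambda>y. pochhammer (y + 1) n) \<longlongrightarrow> pochhammer (x + 1) n) (at x)"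
    using poch_cont[of 1 1 n] by (simp add: isCont_def)
  then have "eventually (\<lambda>y. pochhammer (y + 1) n \<noteq> 0) (at x)"
    using nz by (rule tendsto_imp_eventually_ne)
  \<comment> \<open>The filter \<open>at x\<close> is punctured, so this holds even if
    \<open>x\<close> is the exceptional point.\<close>
  moreover have "eventually (\<lambda>y. y \<noteq> - (of_nat n + 1) / 2) (at x)"
    by (rule eventually_neq_at_within)
  ultimately have "eventually (\<lambda>y. jacobi_sum y n = 1) (at x)"
  proof eventually_elim
    case (elim y)
    then have "2 * y + of_nat n + 1 \<noteq> 0"
      by (auto simp: field_simps eq_neg_iff_add_eq_0)
    with elim(1) show ?case by (rule generic)
  qed
  then have "((\<lambda>y. jacobi_sum y n) \<longlongrightarrow> 1) (at x)"
    by (rule tendsto_eventually)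
  with lim show ?thesis
    by (rule tendsto_unique[rotated]) simp
qed

text \<open>Here 2x + n + 1 = 2(x + m + 1), and x + m + 1 is one of the factors of the nonzero
  \<open>pochhammer (x + 1) n\<close>, so it can be cancelled directly.\<close>

lemma jacobi_sum_odd:
  assumes nz: "pochhammer (x + 1) n \<noteq> 0" and n: "n = 2 * m + 1"
  shows "jacobi_sum x n = - of_nat (m + 1) / (x + of_nat (m + 1))"
proof -
  have "x + of_nat (m + 1) \<noteq> 0"
    using nz[unfolded pochhammer_nonzero_iff_shift, rule_format, of "m + 1"] n by simp
  moreover have "2 * ((x + of_nat (m + 1)) * jacobi_sum x n) = 2 * (- of_nat (m + 1))"
    using jacobi_sum_times[OF nz] by (simp add: n algebra_simps)
  ultimately show ?thesis
    by (subst (asm) mult_cancel_left) (simp add: field_simps)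
qed

section \<open>Telescoping and summation by parts\<close>

text \<open>Terms of 2F1(-n, 2x + n + 1; x + 1; t) at t = 1: up to normalisation, the Jacobi
  polynomial with both parameters \<open>x\<close>, taken at -1.\<close>

definition jacobi_term :: "complex \<Rightarrow> nat \<Rightarrow> nat \<Rightarrow> complex" where
  "jacobi_term x n k = (- 1) ^ k * of_nat (n choose k)
     * (pochhammer (2 * x + of_nat n + 1) k / pochhammer (x + 1) k)"

text \<open>Closed form of the partial sums up to \<open>k\<close> of \<open>jacobi_term\<close> for
  \<open>n\<close> and \<open>Suc n\<close> added together; both start with the value 2 at k =
  0.\<close>

definition jacobi_cert :: "complex \<Rightarrow> nat \<Rightarrow> nat \<Rightarrow> complex" where
  "jacobi_cert x n k = 2 * ((- 1) ^ k * of_nat (n choose k)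
     * (pochhammer (2 * x + of_nat n + 2) k / pochhammer (x + 1) k))"

text \<open>The certificate comes from Gosper's algorithm.\<close>

lemma jacobi_term_telescopes:
  assumes nz: "pochhammer (x + 1) (Suc k) \<noteq> 0"
  shows "jacobi_term x (Suc n) (Suc k) + jacobi_term x n (Suc k)
       = jacobi_cert x n (Suc k) - jacobi_cert x n k"
proof -
  define A B :: complex where "A = of_nat (n choose k)" and "B = of_nat (n choose Suc k)"
  define p q where "p = pochhammer (2 * x + of_nat n + 2) k" and "q = pochhammer (x + 1) k"
  have q: "pochhammer (x + 1) (Suc k) = (x + 1 + of_nat k) * q"
    unfolding q_def by (rule pochhammer_rec')
  with nz have nz': "q \<noteq> 0" "x + 1 + of_nat k \<noteq> 0" by auto
  have p1: "pochhammer (2 * x + of_nat n + 2) (Suc k) = (2 * x + of_nat n + 2 + of_nat k) * p"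
    unfolding p_def by (rule pochhammer_rec')
  have p2: "pochhammer (2 * x + of_nat n + 1) (Suc k) = (2 * x + of_nat n + 1) * p"
    unfolding p_def by (simp add: pochhammer_rec add_ac)
  have arg: "2 * x + of_nat (Suc n) + 1 = 2 * x + of_nat n + 2"
    by simp
  have "(n choose Suc k) * Suc k = (n choose k) * (n - k)"
    using binomial_absorption[of k n] binomial_absorb_comp[of n k] by (simp only: mult.commute)
  \<comment> \<open>Removes the truncated subtraction; for \<open>k > n\<close> both binomials
    vanish.\<close>
  then have "(n choose Suc k) * Suc k + (n choose k) * k = (n choose k) * n"
    by (cases "k \<le> n") (simp_all add: binomial_eq_0 flip: distrib_left)
  then have AB: "B * (of_nat k + 1) + A * of_nat k = A * of_nat n"
    unfolding A_def B_def by (metis of_nat_Suc of_nat_add of_nat_mult add.commute)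
  \<comment> \<open>The telescoping relation cleared of its common factors, with
    \<open>A + B\<close> from Pascal's rule; it reduces to \<open>AB\<close>.\<close>
  have "(A + B) * (2 * x + of_nat n + 2 + of_nat k) + B * (2 * x + of_nat n + 1)
      = 2 * B * (2 * x + of_nat n + 2 + of_nat k) + 2 * A * (x + 1 + of_nat k)"
    using AB by algebra
  \<comment> \<open>Restores those factors, with \<open>u\<close>, \<open>v\<close>,
    \<open>w\<close> standing for the linear factors gained in passing from \<open>k\<close> to
    \<open>Suc k\<close>.\<close>
  moreover have "(- 1) ^ Suc k * (A + B) * (u * p / (w * q)) + (- 1) ^ Suc k * B * (v * p / (w * q))
      = 2 * ((- 1) ^ Suc k * B * (u * p / (w * q))) - 2 * ((- 1) ^ k * A * (p / q))"
    if w: "w \<noteq> 0" and uvw: "(A + B) * u + B * v = 2 * B * u + 2 * A * w" for u v w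
  proof -
    define r where "r = (- 1) ^ k * (p / (w * q))"
    have "(- 1) ^ Suc k * (A + B) * (u * p / (w * q)) + (- 1) ^ Suc k * B * (v * p / (w * q))
        = - (r * ((A + B) * u + B * v))"
      by (simp add: r_def ring_distribs add_divide_distrib diff_divide_distrib mult_ac)
    also have "\<dots> = - (r * (2 * B * u)) - 2 * (A * (r * w))"
      unfolding uvw by (simp add: ring_distribs)
    also have "r * w = (- 1) ^ k * (p / q)"
      using w by (simp add: r_def)
    finally show ?thesis
      by (simp add: r_def mult_ac)
  qed
  ultimately show ?thesis
    unfolding jacobi_term_def jacobi_cert_def arg p1 p2 q
    unfolding binomial_Suc_Suc of_nat_add A_def[symmetric] B_def[symmetric] p_def[symmetric] q_def[symmetric]
    using nz'(2) by blast
qed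

text \<open>Abel summation, using that \<open>harm\<close> grows by 1/(k + 1) and starts at 0. The
  bound \<open>M\<close> is kept apart from \<open>n\<close> so that induction can run on it
  alone.\<close>

lemma sum_jacobi_term_harm_partial:
  assumes "pochhammer (x + 1) M \<noteq> 0"
  shows "(\<Sum>k\<le>M. (jacobi_term x (Suc n) k + jacobi_term x n k) * harm k)
       = harm M * jacobi_cert x n M - (\<Sum>k<M. jacobi_cert x n k / of_nat (Suc k))"
  using assms
proof (induction M)
  case 0
  show ?case by (simp add: harm_def)
next
  case (Suc M)
  then have "pochhammer (x + 1) M \<noteq> 0"
    using pochhammer_nonzero_mono[of "x + 1" "Suc M" M] by simp
  note IH = Suc.IH[OF this]
  show ?case
    unfolding sum.atMost_Suc sum.lessThan_Suc IH jacobi_term_telescopes[OF Suc.prems] harm_Suc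
    by (simp add: inverse_eq_divide ring_distribs diff_divide_distrib del: of_nat_Suc)
qed

lemma sum_jacobi_term_harm_Suc:
  assumes nz: "pochhammer (x + 1) (Suc n) \<noteq> 0"
  shows "(\<Sum>k\<le>Suc n. jacobi_term x (Suc n) k * harm k) + (\<Sum>k\<le>n. jacobi_term x n k * harm k)
       = - 2 * jacobi_sum x n / of_nat (Suc n)"
proof -
  \<comment> \<open>Both contain \<open>n choose Suc n\<close>: the two sums can share the range up
    to \<open>Suc n\<close>, and the boundary term disappears.\<close>
  have "jacobi_term x n (Suc n) = 0" "jacobi_cert x n (Suc n) = 0"
    by (simp_all add: jacobi_term_def jacobi_cert_def)
  then have "(\<Sum>k\<le>Suc n. jacobi_term x (Suc n) k * harm k) + (\<Sum>k\<le>n. jacobi_term x n k * harm k)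
      = - (\<Sum>k\<le>n. jacobi_cert x n k / of_nat (Suc k))"
    using sum_jacobi_term_harm_partial[OF nz, of n]
    by (simp add: distrib_right sum.distrib lessThan_Suc_atMost)
  also have "(\<Sum>k\<le>n. jacobi_cert x n k / of_nat (Suc k)) = 2 * jacobi_sum x n / of_nat (Suc n)"
    unfolding jacobi_sum_def sum_distrib_left sum_divide_distrib
  proof (rule sum.cong)
    fix k
    have "of_nat (Suc k) * of_nat (Suc n choose Suc k) = (of_nat (Suc n) * of_nat (n choose k) :: complex)"
      using Suc_times_binomial_eq[of n k] by (metis of_nat_mult mult.commute)
    then have "of_nat (n choose k) / of_nat (Suc k) = (of_nat (Suc n choose Suc k) / of_nat (Suc n) :: complex)"
      by (simp add: field_simps del: of_nat_Suc binomial_Suc_Suc)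
    then show "jacobi_cert x n k / of_nat (Suc k) = 2 * ((- 1) ^ k * of_nat (Suc n choose Suc k)
         * (pochhammer (2 * x + of_nat n + 2) k / pochhammer (x + 1) k)) / of_nat (Suc n)"
      unfolding jacobi_cert_def
      by (metis (no_types, opaque_lifting) times_divide_eq_left times_divide_eq_right mult.commute)
  qed simp
  finally show ?thesis by simp
qed

section \<open>Closed form by induction on \<open>n\<close>\<close>

text \<open>Both parities are merged through \<open>n div 2\<close> and the sign, since the
  recurrence links each \<open>n\<close> to a neighbour of opposite parity.\<close>

lemma sum_jacobi_term_harm:
  assumes "pochhammer (x + 1) n \<noteq> 0"
  shows "(\<Sum>k\<le>n. jacobi_term x n k * harm k)
       = (- 1) ^ n * (gen_harm (n div 2) x + 2 * harm n - harm (n div 2))"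
  using assms
proof (induction n)
  case 0
  show ?case by (simp add: gen_harm_def harm_def)
next
  case (Suc n)
  have nz: "pochhammer (x + 1) n \<noteq> 0"
    using pochhammer_nonzero_mono[OF Suc.prems, of n] by simp
  have step: "(\<Sum>k\<le>Suc n. jacobi_term x (Suc n) k * harm k)
      = - ((- 1) ^ n * (gen_harm (n div 2) x + 2 * harm n - harm (n div 2)))
        - 2 * jacobi_sum x n / of_nat (Suc n)"
    using sum_jacobi_term_harm_Suc[OF Suc.prems] unfolding Suc.IH[OF nz]
    by (simp add: eq_diff_eq eq_neg_iff_add_eq_0 add_ac del: sum.atMost_Suc of_nat_Suc)
  show ?case
  proof (cases "even n")
    \<comment> \<open>Only \<open>2 * harm n\<close> changes, by 2/(n + 1), which matches
      \<open>jacobi_sum x n = 1\<close>.\<close>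
    case True
    then have "Suc n div 2 = n div 2" by simp
    then show ?thesis
      unfolding step using True jacobi_sum_even[OF nz True]
      by (simp add: harm_Suc algebra_simps inverse_eq_divide del: of_nat_Suc)
  next
    case False
    then obtain m where n: "n = 2 * m + 1" by (elim oddE)
    have half: "Suc n div 2 = Suc m" "n div 2 = m" using n by simp_all
    have Suc_n: "of_nat (Suc n) = (2 * of_nat (Suc m) :: complex)" by (simp add: n)
    have "- 2 * jacobi_sum x n / of_nat (Suc n) = 1 / (x + of_nat (Suc m))"
      unfolding jacobi_sum_odd[OF nz n] Suc_n
      by (simp add: divide_simps del: of_nat_Suc)
    \<comment> \<open>As n + 1 = 2(m + 1), the two harmonic increments cancel; the residual sum
      supplies just the new term of \<open>gen_harm\<close>.\<close>
    moreover have "2 * harm (Suc n) - harm (Suc m) = 2 * harm n - (harm m :: complex)"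
      by (simp add: harm_Suc Suc_n inverse_eq_divide del: of_nat_Suc)
    moreover have "gen_harm (Suc m) x = gen_harm m x + 1 / (x + of_nat (Suc m))"
      by (simp add: gen_harm_def)
    ultimately show ?thesis
      unfolding step half using False by (simp del: of_nat_Suc)
  qed
qed

lemma gbinomial_quotient_eq_jacobi_term:
  "(- 1) ^ k * of_nat (n choose k)
     * (((2 * x + of_nat n + of_nat k) gchoose k) / ((x + of_nat k) gchoose k)) = jacobi_term x n k"
  by (simp add: jacobi_term_def gbinomial_pochhammer' add.commute)

theorem theorem1:
  fixes x :: complex and n :: nat
  assumes "\<And>k. k \<le> n \<Longrightarrow> (x + of_nat k) gchoose k \<noteq> 0"
    and "\<And>k. 1 \<le> k \<Longrightarrow> k \<le> n div 2 \<Longrightarrow> x + of_nat k \<noteq> 0"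
  shows "(\<forall>m. n = 2 * m \<longrightarrow>
      (\<Sum>k=0..n. (- 1) ^ k * of_nat (n choose k) *
         (((2 * x + of_nat n + of_nat k) gchoose k) / ((x + of_nat k) gchoose k)) * harm k)
        = gen_harm m x + 2 * harm (2 * m) - harm m)
    \<and> (\<forall>m. n = 2 * m + 1 \<longrightarrow>
      (\<Sum>k=0..n. (- 1) ^ k * of_nat (n choose k) *
         (((2 * x + of_nat n + of_nat k) gchoose k) / ((x + of_nat k) gchoose k)) * harm k)
        = harm m - 2 * harm (2 * m + 1) - gen_harm m x)"
proof -
  \<comment> \<open>The generalized binomial at k = n is
    \<open>pochhammer (x + 1) n / fact n\<close>.\<close>
  have "pochhammer (x + 1) n \<noteq> 0"
    using assms(1)[of n] by (simp add: gbinomial_pochhammer' add.commute)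
  from sum_jacobi_term_harm[OF this] show ?thesis
    unfolding gbinomial_quotient_eq_jacobi_term atLeast0AtMost by auto
qed

end
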